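(* A monotonicity constraint system (MCS) $\mathcal A$ is terminating if and only if it is size-change terminating.
   Context: Fix a number $n$ of variables. A monotonicity constraint (MC) is a finite conjunction of constraints $u\rhd v$ with $\rhd\in\{>,\ge\}$ and $u,v\in\{x_1,\dots,x_n,x_1',\dots,x_n'\}$ (unprimed: source state; primed: target state; $u=v$ abbreviates $u\ge v\wedge v\ge u$). It is identified with the labeled digraph on these $2n$ nodes having an arc $u\to v$ labeled $\rhd$ for each constraint $u\rhd v$; arcs labeled $>$ are called strict, arcs labeled $\ge$ non-strict. An MCS $\mathcal A$ consists of a finite set $F$ of flow-points; a finite directed graph (control-flow graph, CFG; loops and parallel arcs allowed) on $F$; for every CFG arc $f\to g$ an MC $G$ labeling it (written $G:f\to g$); and for every flow-point $f$ an invariant $I_f$, a conjunction of constraints $u\rhd v$ with $u,v\in\{x_1,\dots,x_n\}$ (also viewed as labeled arcs). Semantics: let $\mathit{Val}$ be a well-ordered set. A state is a pair $(f,\sigma)$ with $f\in F$, $\sigma:\{1,\dots,n\}\to\mathit{Val}$. For $G:f\to g$ in $\mathcal A$, there is a transition $(f,\sigma)\mapsto(g,\sigma')$ if $\sigma\models I_f$, $\sigma'\models I_g$ and $\sigma,\sigma'\models G$ (unprimed variables valued by $\sigma$, primed by $\sigma'$). $\mathcal A$ is terminating if, for every choice of well-ordered set $\mathit{Val}$, there is no infinite sequence of states in which each consecutive pair is a transition described by some MC of $\mathcal A$. Multipaths: for a (finite or infinite) labeled CFG path $f_0\xrightarrow{G_1}f_1\xrightarrow{G_2}f_2\cdots$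 (repetitions allowed), the corresponding $\mathcal A$-multipath is the labeled digraph with nodes $x[t,i]$ ($t$ from $0$ up to the length of the path, $1\le i\le n$), whose arcs are: for each $t\ge1$, the arcs of $G_t$ with $x_i$ renamed to $x[t-1,i]$ and $x_j'$ renamed to $x[t,j]$; and for each $t\ge0$, the arcs of $I_{f_t}$ with $x_i$ renamed to $x[t,i]$. A walk (nodes and arcs may repeat; arcs may go forward, backward or stay at the same $t$) is infinitely descending if it contains infinitely many occurrences of strict arcs (in particular, going forever around a cycle containing a strict arc counts). $\mathcal A$ is size-change terminating if every infinite $\mathcal A$-multipath has an infinitely descending walk. *)

theory Defs
  imports Main "HOL-Library.FuncSet" "Graph_Theory.Digraph"
begin

datatype cmp = Gt | Ge

text \<open>
  An arc \<open>(u, c, v)\<close> stands for the constraint \<open>u c v\<close>, so arcs point from the larger to the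
  smaller side.
\<close>

type_synonym 'a labeled_arc = "'a \<times> cmp \<times> 'a"

abbreviation arc_src :: "'a labeled_arc \<Rightarrow> 'a" where "arc_src a \<equiv> fst a"
abbreviation arc_lab :: "'a labeled_arc \<Rightarrow> cmp" where "arc_lab a \<equiv> fst (snd a)"
abbreviation arc_tgt :: "'a labeled_arc \<Rightarrow> 'a" where "arc_tgt a \<equiv> snd (snd a)"

text \<open>\<open>Unprimed i\<close> is $x_i$ and \<open>Primed i\<close> is $x_i'$; variables are numbered from 1.\<close>

datatype mcvar = Unprimed nat | Primed nat

type_synonym mc = "mcvar labeled_arc set"
type_synonym invariant = "nat labeled_arc set"

definition mcvars :: "nat \<Rightarrow> mcvar set" where
  "mcvars n = Unprimed ` {1..n} \<union> Primed ` {1..n}"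

definition arcs_on :: "'a set \<Rightarrow> 'a labeled_arc set" where
  "arcs_on N = N \<times> UNIV \<times> N"

text \<open>
  The control-flow graph is a digraph of the graph library, where arcs have an identity of their
  own, so that loops and parallel arcs are allowed; \<open>verts (cfg A)\<close> is the set of flow-points.
\<close>

record ('f, 'e) mcs =
  nvars :: nat
  cfg :: "('f, 'e) pre_digraph"
  mc_of :: "'e \<Rightarrow> mc"
  invar :: "'f \<Rightarrow> invariant"

text \<open>
  Finiteness of the constraint sets is not demanded separately: there are only finitely many arcs on
  the given variables.
\<close>

definition is_mcs :: "('f, 'e) mcs \<Rightarrow> bool" where
  "is_mcs A \<longleftrightarrow> fin_digraph (cfg A)
     \<and> (\<forall>e \<in> arcs (cfg A). mc_of A e \<subseteq> arcs_on (mcvars (nvars A)))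
     \<and> (\<forall>f \<in> verts (cfg A). invar A f \<subseteq> arcs_on {1..nvars A})"


section \<open>Semantics\<close>

text \<open>Here \<open>(a, b) \<in> r\<close> means that \<open>a\<close> is less than or equal to \<open>b\<close>.\<close>

fun cmp_holds :: "'v rel \<Rightarrow> cmp \<Rightarrow> 'v \<Rightarrow> 'v \<Rightarrow> bool" where
  "cmp_holds r Ge a b \<longleftrightarrow> (b, a) \<in> r"
| "cmp_holds r Gt a b \<longleftrightarrow> (b, a) \<in> r \<and> a \<noteq> b"

definition satisfies :: "'v rel \<Rightarrow> ('a \<Rightarrow> 'v) \<Rightarrow> 'a labeled_arc set \<Rightarrow> bool" where
  "satisfies r val C \<longleftrightarrow> (\<forall>(u, c, v) \<in> C. cmp_holds r c (val u) (val v))"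

fun mcvar_val :: "(nat \<Rightarrow> 'v) \<Rightarrow> (nat \<Rightarrow> 'v) \<Rightarrow> mcvar \<Rightarrow> 'v" where
  "mcvar_val \<sigma> \<sigma>' (Unprimed i) = \<sigma> i"
| "mcvar_val \<sigma> \<sigma>' (Primed i) = \<sigma>' i"

type_synonym ('f, 'v) state = "'f \<times> (nat \<Rightarrow> 'v)"

definition states :: "('f, 'e) mcs \<Rightarrow> 'v set \<Rightarrow> ('f, 'v) state set" where
  "states A Val = verts (cfg A) \<times> ({1..nvars A} \<rightarrow>\<^sub>E Val)"

definition transition ::
  "('f, 'e) mcs \<Rightarrow> 'v rel \<Rightarrow> 'e \<Rightarrow> ('f, 'v) state \<Rightarrow> ('f, 'v) state \<Rightarrow> bool" where
  "transition A r e s s' \<longleftrightarrow>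
     tail (cfg A) e = fst s \<and> head (cfg A) e = fst s'
     \<and> satisfies r (snd s) (invar A (fst s))
     \<and> satisfies r (snd s') (invar A (fst s'))
     \<and> satisfies r (mcvar_val (snd s) (snd s')) (mc_of A e)"

definition terminating_over :: "('f, 'e) mcs \<Rightarrow> 'v set \<Rightarrow> 'v rel \<Rightarrow> bool" where
  "terminating_over A Val r \<longleftrightarrow>
     \<not> (\<exists>s :: nat \<Rightarrow> ('f, 'v) state.
          (\<forall>k. s k \<in> states A Val)
        \<and> (\<forall>k. \<exists>e \<in> arcs (cfg A). transition A r e (s k) (s (Suc k))))"

text \<open>
  Termination quantifies over all well-ordered sets, which HOL can do only within a type: the type
  \<open>'v\<close> is the universe from which the carrier \<open>Val\<close> is drawn, and the well-order on \<open>Val\<close> is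
  arbitrary (it is unrelated to any order on \<open>'v\<close>). Over an infinite \<open>'v\<close>, this covers up to
  isomorphism every well-ordered set of cardinality at most that of \<open>'v\<close>; a statement polymorphic
  in an infinite \<open>'v\<close> therefore covers all well-ordered sets.
\<close>

definition terminating :: "'v itself \<Rightarrow> ('f, 'e) mcs \<Rightarrow> bool" where
  "terminating _ A \<longleftrightarrow> (\<forall>(Val :: 'v set) r. well_order_on Val r \<longrightarrow> terminating_over A Val r)"


section \<open>Multipaths and size-change termination\<close>

text \<open>
  An infinite control-flow path is given by its arcs: arc \<open>p t\<close> leads from $f_t$ to $f_{t+1}$ and
  carries $G_{t+1}$.
\<close>

definition infinite_cfg_path :: "('f, 'e) mcs \<Rightarrow> (nat \<Rightarrow> 'e) \<Rightarrow> bool" where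
  "infinite_cfg_path A p \<longleftrightarrow>
     (\<forall>t. p t \<in> arcs (cfg A)) \<and> (\<forall>t. head (cfg A) (p t) = tail (cfg A) (p (Suc t)))"

text \<open>The node $x[t,i]$ is the pair \<open>(t, i)\<close>.\<close>

type_synonym node = "nat \<times> nat"

fun node_of :: "nat \<Rightarrow> mcvar \<Rightarrow> node" where
  "node_of t (Unprimed i) = (t, i)"
| "node_of t (Primed i) = (Suc t, i)"

definition multipath_arcs :: "('f, 'e) mcs \<Rightarrow> (nat \<Rightarrow> 'e) \<Rightarrow> node labeled_arc set" where
  "multipath_arcs A p =
     {(node_of t u, c, node_of t v) | t u c v. (u, c, v) \<in> mc_of A (p t)}
   \<union> {((t, i), c, (t, j)) | t i c j. (i, c, j) \<in> invar A (tail (cfg A) (p t))}"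

definition infinite_walk :: "'a labeled_arc set \<Rightarrow> (nat \<Rightarrow> 'a labeled_arc) \<Rightarrow> bool" where
  "infinite_walk M w \<longleftrightarrow> (\<forall>k. w k \<in> M) \<and> (\<forall>k. arc_tgt (w k) = arc_src (w (Suc k)))"

definition infinitely_descending :: "(nat \<Rightarrow> 'a labeled_arc) \<Rightarrow> bool" where
  "infinitely_descending w \<longleftrightarrow> infinite {k. arc_lab (w k) = Gt}"

definition size_change_terminating :: "('f, 'e) mcs \<Rightarrow> bool" where
  "size_change_terminating A \<longleftrightarrow>
     (\<forall>p. infinite_cfg_path A p \<longrightarrow>
        (\<exists>w. infinite_walk (multipath_arcs A p) w \<and> infinitely_descending w))"

end

theory Submission
  imports Defs
begin

text \<open>
  A run of \<open>A\<close> values the nodes of its multipath so that values never increase along arcs and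
  decrease along strict ones, so an infinitely descending walk is impossible over a well-order.
  Conversely, if a multipath has no infinitely descending walk, then the relation \<open>u > v\<close>,
  ``some walk from \<open>u\<close> to \<open>v\<close> ends with a strict arc'', is well-founded, and valuing each node by
  its ordinal rank satisfies all the constraints: a non-strict arc from \<open>u\<close> to \<open>v\<close> makes every
  node below \<open>v\<close> a node below \<open>u\<close>. Only countably many ranks occur, hence they can be realised
  by a well-order on a subset of any infinite type.
\<close>

section \<open>Ranks of a well-founded relation\<close>

text \<open>
  Comparison of ordinal ranks without ordinals: \<open>rank_le S u v\<close> says that the rank of \<open>u\<close> is at
  most that of \<open>v\<close>.
\<close>

inductive rank_le :: "'a rel \<Rightarrow> 'a \<Rightarrow> 'a \<Rightarrow> bool" for S where
  rank_leI: "(\<And>u'. (u', u) \<in> S \<Longrightarrow> \<exists>v'. (v', v) \<in> S \<and> rank_le S u' v') \<Longrightarrow> rank_le S u v"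

lemma rank_leD: "rank_le S u v \<Longrightarrow> (u', u) \<in> S \<Longrightarrow> \<exists>v'. (v', v) \<in> S \<and> rank_le S u' v'"
  by (erule rank_le.cases) simp

lemma rank_le_refl:
  assumes "wf S"
  shows "rank_le S u u"
  using assms
proof (induction u)
  case (less u)
  then show ?case by (metis rank_leI)
qed

lemma rank_le_trans:
  assumes "rank_le S u v" "rank_le S v w"
  shows "rank_le S u w"
  using assms
proof (induction arbitrary: w rule: rank_le.induct)
  case (rank_leI u v)
  show ?case
  proof (rule rank_le.rank_leI)
    fix u' assume "(u', u) \<in> S"
    with rank_leI show "\<exists>w'. (w', w) \<in> S \<and> rank_le S u' w'"
      by (meson rank_leD)
  qed
qed

lemma not_rank_leD:
  assumes "\<not> rank_le S u v"
  shows "\<exists>u'. (u', u) \<in> S \<and> (\<forall>v'. (v', v) \<in> S \<longrightarrow> \<not> rank_le S u' v')"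
  using assms rank_leI[of u S v] by metis

text \<open>Well-founded induction on \<open>u\<close>: if the comparison fails, some
  \<open>u'\<close> below \<open>u\<close> is dominated by nothing below \<open>v\<close>, so by
  induction \<open>u'\<close> dominates everything below \<open>v\<close>.\<close>

lemma rank_le_total:
  assumes "wf S"
  shows "rank_le S u v \<or> rank_le S v u"
  using assms
proof (induction u arbitrary: v)
  case (less u)
  show ?case
  proof (cases "rank_le S u v")
    case False
    then obtain u' where u': "(u', u) \<in> S" "\<And>v'. (v', v) \<in> S \<Longrightarrow> \<not> rank_le S u' v'"
      by (auto dest: not_rank_leD)
    have "rank_le S v u"
    proof (rule rank_leI)
      fix v' assume "(v', v) \<in> S"
      with u' less.IH show "\<exists>u'. (u', u) \<in> S \<and> rank_le S v' u'" by metis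
    qed
    then show ?thesis ..
  qed simp
qed

text \<open>Take as witness a \<open>u'\<close> below \<open>u\<close> that is dominated by nothing
  below \<open>v\<close>; induction applied to \<open>u'\<close> and each \<open>v'\<close> below
  \<open>v\<close> shows that it dominates \<open>v\<close>.\<close>

lemma ex_below_if_not_rank_le:
  assumes "wf S" "\<not> rank_le S u v"
  shows "\<exists>u'. (u', u) \<in> S \<and> rank_le S v u'"
  using assms
proof (induction u arbitrary: v)
  case (less u)
  then obtain u' where u': "(u', u) \<in> S" "\<And>v'. (v', v) \<in> S \<Longrightarrow> \<not> rank_le S u' v'"
    by (auto dest: not_rank_leD)
  have "rank_le S v u'"
  proof (rule rank_leI)
    fix v' assume "(v', v) \<in> S"
    with u' show "\<exists>u''. (u'', u') \<in> S \<and> rank_le S v' u''"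
      by (intro less.IH)
  qed
  with u'(1) show ?case by blast
qed

text \<open>Otherwise one unfolding yields \<open>v'\<close> below \<open>v\<close> with
  \<open>rank_le S v v'\<close>, which the induction hypothesis at \<open>v'\<close>
  excludes.\<close>

lemma not_rank_le_if_less:
  assumes "wf S" "(v, u) \<in> S"
  shows "\<not> rank_le S u v"
  using assms
proof (induction v arbitrary: u)
  case (less v)
  then show ?case by (meson rank_leD)
qed

text \<open>By induction on \<open>u\<close>, every \<open>v\<close> of rank at most that of
  \<open>u\<close> is accessible: a strict drop from \<open>v\<close> is dominated by some element
  below \<open>v\<close>, hence by some \<open>u'\<close> below \<open>u\<close>.\<close>

lemma wf_not_rank_le:
  assumes "wf S"
  shows "wf {(v, u). \<not> rank_le S u v}" (is "wf ?R")
proof -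
  have "v \<in> Wellfounded.acc ?R" if "rank_le S v u" for u v
    using assms that
  proof (induction u arbitrary: v)
    case (less u)
    show ?case
    proof (rule accI)
      fix w assume "(w, v) \<in> ?R"
      then obtain v' where "(v', v) \<in> S" "rank_le S w v'"
        using ex_below_if_not_rank_le[OF assms] by blast
      moreover then obtain u' where "(u', u) \<in> S" "rank_le S v' u'"
        using rank_leD[OF less.prems] by blast
      ultimately show "w \<in> Wellfounded.acc ?R"
        using less.IH rank_le_trans by metis
    qed
  qed
  then show ?thesis
    using rank_le_refl[OF assms] by (blast intro: acc_wfI)
qed

text \<open>
  The values are the images under \<open>g\<close> of chosen representatives of the classes of equal rank.
\<close>

lemma ex_well_order_rank:
  fixes S :: "'a rel" and g :: "'a \<Rightarrow> 'v"
  assumes "wf S" "inj g"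
  obtains Val :: "'v set" and r and f :: "'a \<Rightarrow> 'v"
  where "well_order_on Val r" "range f \<subseteq> Val" "\<And>u v. (f u, f v) \<in> r \<longleftrightarrow> rank_le S u v"
proof
  define f where "f u = g (SOME w. rank_le S w u \<and> rank_le S u w)" for u
  define r where "r = {(f u, f v) | u v. rank_le S u v}"
  note trans = rank_le_trans[of S]
  have f_eq_iff: "f u = f v \<longleftrightarrow> rank_le S u v \<and> rank_le S v u" for u v
  proof
    assume eq: "f u = f v"
    have "\<exists>w. f x = g w \<and> rank_le S w x \<and> rank_le S x w" for x
      unfolding f_def by (rule someI2[of _ x]) (auto intro: rank_le_refl assms(1))
    with eq show "rank_le S u v \<and> rank_le S v u"
      using trans injD[OF assms(2)] by metis
  next
    assume "rank_le S u v \<and> rank_le S v u"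
    \<comment> \<open>Equal predicates make \<open>SOME\<close> pick the same
      representative.\<close>
    then have "(\<lambda>w. rank_le S w u \<and> rank_le S u w) = (\<lambda>w. rank_le S w v \<and> rank_le S v w)"
      using trans by blast
    then show "f u = f v" by (simp add: f_def)
  qed
  show r_iff: "(f u, f v) \<in> r \<longleftrightarrow> rank_le S u v" for u v
  proof
    assume "(f u, f v) \<in> r"
    then obtain u' v' where "f u = f u'" "f v = f v'" "rank_le S u' v'"
      unfolding r_def by blast
    then show "rank_le S u v"
      unfolding f_eq_iff by (blast intro: trans)
  qed (auto simp: r_def)
  show "range f \<subseteq> range f" ..
  have "r \<subseteq> range f \<times> range f"
    by (auto simp: r_def)
  moreover have "refl_on (range f) r"
    by (auto simp: refl_on_def r_iff rank_le_refl[OF assms(1)])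
  moreover have "trans r"
  proof (rule transI)
    fix x y z assume "(x, y) \<in> r" "(y, z) \<in> r"
    moreover then obtain u v w where "x = f u" "y = f v" "z = f w"
      by (auto simp: r_def)
    ultimately show "(x, z) \<in> r" by (auto simp: r_iff intro: trans)
  qed
  moreover have "antisym r"
  proof (rule antisymI)
    fix x y assume "(x, y) \<in> r" "(y, x) \<in> r"
    moreover then obtain u v where "x = f u" "y = f v"
      by (auto simp: r_def)
    ultimately show "x = y" by (simp add: r_iff f_eq_iff)
  qed
  moreover have "total_on (range f) r"
    by (auto simp: total_on_def r_iff rank_le_total[OF assms(1)])
  moreover have "wf (r - Id)"
  proof (rule wfI_min)
    fix x Q assume "x \<in> (Q :: 'v set)"
    show "\<exists>z\<in>Q. \<forall>y. (y, z) \<in> r - Id \<longrightarrow> y \<notin> Q"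
    proof (cases "f -` Q = {}")
      case True
      \<comment> \<open>\<open>r\<close> lives on \<open>range f\<close>, which \<open>Q\<close>
        misses, so \<open>x\<close> itself is minimal.\<close>
      then have "(y, x) \<notin> r" if "y \<in> Q" for y
        using that by (auto simp: r_def)
      with \<open>x \<in> Q\<close> show ?thesis by blast
    next
      case False
      \<comment> \<open>Pull \<open>Q\<close> back along \<open>f\<close> and take a node of least
        rank.\<close>
      obtain u where u: "u \<in> f -` Q"
          "\<And>v. (v, u) \<in> {(v, u). \<not> rank_le S u v} \<Longrightarrow> v \<notin> f -` Q"
        by (rule wfE_min'[OF wf_not_rank_le[OF assms(1)] False]) (rule that)
      have "y \<notin> Q" if "(y, f u) \<in> r - Id" for y
      proof -
        from that obtain v where "y = f v" by (auto simp: r_def)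
        with that u(2)[of v] show ?thesis by (auto simp: r_iff f_eq_iff)
      qed
      with u(1) show ?thesis by blast
    qed
  qed
  ultimately show "well_order_on (range f) r"
    by (simp add: well_order_on_def linear_order_on_def partial_order_on_def preorder_on_def)
qed


section \<open>Infinitely descending walks\<close>

text \<open>The lower node comes first, as \<open>wf\<close> expects. Arcs of either kind may
  precede the final strict one, so an arc can be prepended freely.\<close>

definition walk_above :: "'a labeled_arc set \<Rightarrow> 'a rel" where
  "walk_above M = {(v, u). \<exists>x. (u, x) \<in> {(a, b). \<exists>c. (a, c, b) \<in> M}\<^sup>* \<and> (x, Gt, v) \<in> M}"

text \<open>
  An infinite descent in the relation is turned into a walk by always following a shortest path to
  the next strict arc: the distance \<open>d\<close> to it drops until the strict arc is taken.
\<close>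

lemma wf_walk_above:
  assumes "\<nexists>w. infinite_walk M w \<and> infinitely_descending w"
  shows "wf (walk_above M)"
proof (rule ccontr)
  define E where "E = {(a, b). \<exists>c. (a, c, b) \<in> M}"
  assume "\<not> wf (walk_above M)"
  then obtain Q q where q: "q \<in> Q" and Q: "\<forall>u\<in>Q. \<exists>v\<in>Q. (v, u) \<in> walk_above M"
    unfolding wf_eq_minimal by metis
  \<comment> \<open>Closing \<open>Q\<close> under predecessors keeps the nodes passed on the way to
    the next strict arc inside the set.\<close>
  define Q' where "Q' = {u. \<exists>v\<in>Q. (u, v) \<in> E\<^sup>*}"
  define P where "P u n \<longleftrightarrow> (\<exists>x v. (u, x) \<in> E ^^ n \<and> (x, Gt, v) \<in> M \<and> v \<in> Q')" for u n
  \<comment> \<open>Meaningful on \<open>Q'\<close> only, where \<open>ex_P\<close> shows that the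
    minimum exists.\<close>
  define d where "d u = (LEAST n. P u n)" for u
  have ex_P: "\<exists>n. P u n" if "u \<in> Q'" for u
  proof -
    from that obtain v where v: "v \<in> Q" "(u, v) \<in> E\<^sup>*" by (auto simp: Q'_def)
    with Q obtain v' x where v': "v' \<in> Q" "(v, x) \<in> E\<^sup>*" "(x, Gt, v') \<in> M"
      unfolding walk_above_def E_def by blast
    with v obtain n where "(u, x) \<in> E ^^ n"
      by (meson rtrancl_trans rtrancl_imp_relpow)
    moreover from v' have "v' \<in> Q'" by (auto simp: Q'_def)
    ultimately show ?thesis using v' by (auto simp: P_def)
  qed
  \<comment> \<open>Ensures that the second node of a shortest path is again in
    \<open>Q'\<close>.\<close>
  have P_Q': "u \<in> Q'" if "P u n" for u n
  proof -
    from that obtain x v where x: "(u, x) \<in> E\<^sup>*" "(x, Gt, v) \<in> M" "v \<in> Q'"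
      unfolding P_def by (blast intro: relpow_imp_rtrancl)
    then have "(u, v) \<in> E\<^sup>*" by (auto intro: rtrancl_into_rtrancl simp: E_def)
    with x(3) show ?thesis unfolding Q'_def by (blast intro: rtrancl_trans)
  qed
  define ok where "ok a \<longleftrightarrow> a \<in> M \<and> arc_src a \<in> Q' \<and> arc_tgt a \<in> Q'
    \<and> (arc_lab a = Gt \<or> d (arc_tgt a) < d (arc_src a))" for a
  have step: "\<exists>a. ok a \<and> arc_src a = u" if "u \<in> Q'" for u
  proof -
    have P: "P u (d u)" unfolding d_def using ex_P[OF that] by (rule LeastI_ex)
    show ?thesis
    proof (cases "d u")
      case 0
      with P obtain v where "(u, Gt, v) \<in> M" "v \<in> Q'" by (auto simp: P_def)
      with that have "ok (u, Gt, v)" by (simp add: ok_def)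
      then show ?thesis by force
    next
      case (Suc n)
      with P obtain x v where xv: "(u, x) \<in> E ^^ Suc n" "(x, Gt, v) \<in> M" "v \<in> Q'"
        unfolding P_def by metis
      then obtain y where y: "(u, y) \<in> E" "(y, x) \<in> E ^^ n" by (meson relpow_Suc_D2)
      with xv have "P y n" by (auto simp: P_def)
      then have "y \<in> Q'" "d y < d u"
        using P_Q' Suc by (auto simp: d_def intro: Least_le le_imp_less_Suc)
      moreover from y(1) obtain c where "(u, c, y) \<in> M" by (auto simp: E_def)
      ultimately have "ok (u, c, y)" using that by (simp add: ok_def)
      then show ?thesis by force
    qed
  qed
  have "q \<in> Q'" using q by (auto simp: Q'_def)
  then have "\<exists>a. ok a" using step by blast
  moreover have "\<exists>b. ok b \<and> arc_tgt a = arc_src b" if "ok a" for a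
    using step[of "arc_tgt a"] that by (auto simp: ok_def)
  ultimately have "\<exists>w. \<forall>k. ok (w k) \<and> arc_tgt (w k) = arc_src (w (Suc k))"
    by (intro dependent_nat_choice) auto
  then obtain w where ok: "\<And>k. ok (w k)" and link: "\<And>k. arc_tgt (w k) = arc_src (w (Suc k))"
    by auto
  \<comment> \<open>\<open>d\<close> falls at every arc that is not strict, so a strict one cannot
    be postponed forever.\<close>
  have "\<exists>m\<ge>k. arc_lab (w m) = Gt" for k
  proof (induction "d (arc_src (w k))" arbitrary: k rule: less_induct)
    case less
    show ?case
    proof (cases "arc_lab (w k) = Gt")
      case False
      with ok[of k] have "d (arc_src (w (Suc k))) < d (arc_src (w k))"
        by (simp add: ok_def link)
      from less[OF this] show ?thesis by (meson Suc_leD)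
    qed blast
  qed
  then have "infinitely_descending w"
    unfolding infinitely_descending_def infinite_nat_iff_unbounded_le by blast
  moreover have "infinite_walk M w"
    using ok link by (simp add: infinite_walk_def ok_def)
  ultimately show False using assms by blast
qed

lemma ex_well_order_labeling:
  fixes M :: "('a :: countable) labeled_arc set"
  assumes "\<nexists>w. infinite_walk M w \<and> infinitely_descending w"
    and "infinite (UNIV :: 'v set)"
  obtains Val :: "'v set" and r and f :: "'a \<Rightarrow> 'v"
  where "well_order_on Val r" "range f \<subseteq> Val" "satisfies r f M"
proof -
  have wf: "wf (walk_above M)" using assms(1) by (rule wf_walk_above)
  \<comment> \<open>Countably many nodes fit injectively into any infinite type, which supplies the
    values.\<close>
  obtain h :: "nat \<Rightarrow> 'v" where "inj h"
    using assms(2) infinite_countable_subset by blast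
  then have "inj (h \<circ> to_nat :: 'a \<Rightarrow> 'v)" by (simp add: inj_compose)
  from ex_well_order_rank[OF wf this] obtain Val r and f :: "'a \<Rightarrow> 'v"
    where f: "well_order_on Val r" "range f \<subseteq> Val"
      and r: "\<And>u v. (f u, f v) \<in> r \<longleftrightarrow> rank_le (walk_above M) u v" by metis
  have "cmp_holds r c (f u) (f v)" if arc: "(u, c, v) \<in> M" for u c v
  proof -
    have "(x, u) \<in> walk_above M" if "(x, v) \<in> walk_above M" for x
      using that arc unfolding walk_above_def by (blast intro: converse_rtrancl_into_rtrancl)
    then have le: "(f v, f u) \<in> r"
      unfolding r using rank_le_refl[OF wf] by (intro rank_leI) blast
    show ?thesis
    proof (cases c)
      case Gt
      then have "(v, u) \<in> walk_above M" using arc by (auto simp: walk_above_def)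
      then have "(f u, f v) \<notin> r" unfolding r by (rule not_rank_le_if_less[OF wf])
      with le Gt show ?thesis by auto
    qed (use le in simp)
  qed
  then have "satisfies r f M" by (auto simp: satisfies_def)
  with f show thesis by (rule that)
qed

text \<open>Values never increase along the walk, so they are constant once they reach their
  minimum; a later strict arc would go below it.\<close>

lemma no_infinite_descent_if_satisfies:
  assumes r: "well_order_on Val r"
    and sat: "satisfies r f M"
    and w: "infinite_walk M w"
  shows "\<not> infinitely_descending w"
proof
  assume desc: "infinitely_descending w"
  define a where "a k = f (arc_src (w k))" for k
  have "trans r" "antisym r" "wf (r - Id)"
    using r by (auto simp: well_order_on_def linear_order_on_def partial_order_on_def preorder_on_def)
  have holds: "cmp_holds r (arc_lab (w k)) (a k) (a (Suc k))" for k
    using w sat unfolding infinite_walk_def satisfies_def a_def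
    by (metis (no_types, lifting) case_prodD prod.collapse)
  have step: "(a (Suc k), a k) \<in> r" for k
    using holds[of k] by (cases "arc_lab (w k)") auto
  have mono: "(a (Suc (k + i)), a k) \<in> r" for k i
  proof (induction i)
    case (Suc i)
    with step[of "Suc (k + i)"] \<open>trans r\<close> show ?case by (auto dest: transD)
  qed (simp add: step)
  obtain k where k: "\<And>m. (a m, a k) \<notin> r - Id"
    using \<open>wf (r - Id)\<close>[unfolded wf_eq_minimal, rule_format, of "a 0" "range a"] by auto
  obtain m where "k < m" "arc_lab (w m) = Gt"
    using desc unfolding infinitely_descending_def infinite_nat_iff_unbounded by blast
  moreover then obtain i where "m = Suc (k + i)"
    using less_imp_Suc_add by blast
  ultimately have "a m = a k" "(a (Suc m), a m) \<in> r - Id"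
    using k[of m] mono[of k i] holds[of m] by auto
  with k show False by metis
qed


section \<open>Runs and multipaths\<close>

text \<open>Slicing a node labeling by time gives a sequence of valuations; this is the bridge
  between labelings of a multipath and runs.\<close>

lemma satisfies_multipath_iff:
  "satisfies r f (multipath_arcs A p) \<longleftrightarrow>
    (\<forall>t. satisfies r (mcvar_val (\<lambda>i. f (t, i)) (\<lambda>i. f (Suc t, i))) (mc_of A (p t))
      \<and> satisfies r (\<lambda>i. f (t, i)) (invar A (tail (cfg A) (p t))))"
proof -
  have "mcvar_val (\<lambda>i. f (t, i)) (\<lambda>i. f (Suc t, i)) u = f (node_of t u)" for t u
    by (cases u) auto
  then have "satisfies r f (multipath_arcs A p) \<longleftrightarrow>
      (\<forall>t. (\<forall>u c v. (u, c, v) \<in> mc_of A (p t) \<longrightarrow>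
          cmp_holds r c (mcvar_val (\<lambda>i. f (t, i)) (\<lambda>i. f (Suc t, i)) u)
            (mcvar_val (\<lambda>i. f (t, i)) (\<lambda>i. f (Suc t, i)) v))
        \<and> (\<forall>i c j. (i, c, j) \<in> invar A (tail (cfg A) (p t)) \<longrightarrow>
          cmp_holds r c (f (t, i)) (f (t, j))))"
    unfolding satisfies_def multipath_arcs_def by (simp only:) blast
  then show ?thesis
    unfolding satisfies_def by blast
qed

lemma terminating_if_size_change_terminating:
  fixes A :: "('f, 'e) mcs"
  assumes "size_change_terminating A"
  shows "terminating TYPE('v) A"
  unfolding terminating_def terminating_over_def
proof (intro allI impI notI, elim exE conjE)
  fix Val :: "'v set" and r and s :: "nat \<Rightarrow> ('f, 'v) state"
  assume r: "well_order_on Val r"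
    and "\<forall>k. \<exists>e \<in> arcs (cfg A). transition A r e (s k) (s (Suc k))"
  then obtain p where p: "\<And>k. p k \<in> arcs (cfg A)" "\<And>k. transition A r (p k) (s k) (s (Suc k))"
    by metis
  then have "infinite_cfg_path A p"
    by (simp add: infinite_cfg_path_def transition_def)
  with assms obtain w where w: "infinite_walk (multipath_arcs A p) w" "infinitely_descending w"
    by (auto simp: size_change_terminating_def)
  have "satisfies r (\<lambda>(t, i). snd (s t) i) (multipath_arcs A p)"
    using p(2) by (simp add: satisfies_multipath_iff transition_def)
  from no_infinite_descent_if_satisfies[OF r this w(1)] w(2) show False ..
qed

text \<open>Lets a labeling be cut down to the variables \<open>{1..nvars A}\<close>, outside of
  which states are \<open>undefined\<close>.\<close>

lemma satisfies_cong:
  assumes "C \<subseteq> arcs_on N" "\<And>x. x \<in> N \<Longrightarrow> f x = g x"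
  shows "satisfies r f C \<longleftrightarrow> satisfies r g C"
proof -
  have "cmp_holds r c (f u) (f v) \<longleftrightarrow> cmp_holds r c (g u) (g v)" if "(u, c, v) \<in> C" for u c v
    using that assms by (auto simp: arcs_on_def)
  then show ?thesis
    unfolding satisfies_def by blast
qed

lemma size_change_terminating_if_terminating:
  fixes A :: "('f, 'e) mcs"
  assumes A: "is_mcs A"
    and inf: "infinite (UNIV :: 'v set)"
    and "terminating TYPE('v) A"
  shows "size_change_terminating A"
  unfolding size_change_terminating_def
proof (intro allI impI, rule ccontr)
  fix p assume p: "infinite_cfg_path A p"
    and "\<nexists>w. infinite_walk (multipath_arcs A p) w \<and> infinitely_descending w"
  from ex_well_order_labeling[OF this(2) inf] obtain Val :: "'v set" and r f
    where r: "well_order_on Val r" and f: "range f \<subseteq> Val"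
      and sat: "satisfies r f (multipath_arcs A p)" by metis
  \<comment> \<open>Well-formedness of the digraph makes the tails of arcs flow-points.\<close>
  interpret fin_digraph "cfg A" using A by (simp add: is_mcs_def)
  define \<sigma> where "\<sigma> t = restrict (\<lambda>i. f (t, i)) {1..nvars A}" for t
  define s where "s t = (tail (cfg A) (p t), \<sigma> t)" for t
  have arc: "p t \<in> arcs (cfg A)" and link: "head (cfg A) (p t) = tail (cfg A) (p (Suc t))" for t
    using p by (auto simp: infinite_cfg_path_def)
  have states: "s t \<in> states A Val" for t
    using f arc by (auto simp: states_def s_def \<sigma>_def)
  have invar: "satisfies r (\<sigma> t) (invar A (tail (cfg A) (p t)))" for t
  proof -
    have "invar A (tail (cfg A) (p t)) \<subseteq> arcs_on {1..nvars A}"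
      using A arc by (simp add: is_mcs_def)
    from satisfies_cong[OF this, of "\<sigma> t" "\<lambda>i. f (t, i)"] sat
    show ?thesis by (simp add: \<sigma>_def satisfies_multipath_iff)
  qed
  have mc: "satisfies r (mcvar_val (\<sigma> t) (\<sigma> (Suc t))) (mc_of A (p t))" for t
  proof -
    have mc_on: "mc_of A (p t) \<subseteq> arcs_on (mcvars (nvars A))"
      using A arc by (simp add: is_mcs_def)
    have eq: "mcvar_val (\<sigma> t) (\<sigma> (Suc t)) x = mcvar_val (\<lambda>i. f (t, i)) (\<lambda>i. f (Suc t, i)) x"
      if "x \<in> mcvars (nvars A)" for x
      using that by (auto simp: mcvars_def \<sigma>_def)
    from sat have "satisfies r (mcvar_val (\<lambda>i. f (t, i)) (\<lambda>i. f (Suc t, i))) (mc_of A (p t))"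
      by (simp add: satisfies_multipath_iff)
    then show ?thesis
      by (simp only: satisfies_cong[OF mc_on eq])
  qed
  \<comment> \<open>The invariant at the target is \<open>invar\<close> at \<open>Suc t\<close>,
    since \<open>link\<close> identifies the head of \<open>p t\<close> with the next tail.\<close>
  have "transition A r (p t) (s t) (s (Suc t))" for t
    by (simp add: transition_def s_def link invar mc)
  with states arc have "\<not> terminating_over A Val r"
    unfolding terminating_over_def by blast
  with assms(3) r show False by (simp add: terminating_def)
qed

theorem theorem3p8:
  fixes A :: "('f, 'e) mcs"
  assumes "is_mcs A"
    and "infinite (UNIV :: 'v set)"
  shows "terminating TYPE('v) A \<longleftrightarrow> size_change_terminating A"
  using assms terminating_if_size_change_terminating size_change_terminating_if_terminating
  by blast

end
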